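(* Let $f \in L^{\infty}(\mathbb{R})$ denote a function with $0 \leq f \leq 1$, and consider the model $$dS_0 = \rho\, S_0\, dt,\qquad S_0(0) = M\,(1-f(B(T))),$$ $$\delta S_1 = \mu\, S_1\, dt + \sigma\, S_1\, \delta B(t),\qquad S_1(0) = M f(B(T)),$$ on $[0,T]$, where $\delta$ denotes the Hitsuda-Skorokhod stochastic differential, and set $M^{(\mathrm{HS})}(T) := S_0(T)+S_1(T)$. The optimal investment strategy, i.e. the function $f \in L^\infty(\mathbb{R})$ with $0\le f\le 1$ that maximizes $\mathbb{E}\left[M^{(\mathrm{HS})}(T)\right]$ among all such functions, is $$ f(B(T)) = 1.$$
   Context: $\{B(t), t\in[0,T]\}$ is a standard one-dimensional Brownian motion on a probability space $\Omega$ whose $\sigma$-algebra is generated by $B$ (up to completion), $T>0$ is a fixed time horizon, and $M,\rho,\mu,\sigma$ are positive constants with $\mu>\rho$ ($M$ is the total initial wealth, $\rho$ the interest rate of the bank account, $\mu$ and $\sigma$ the appreciation rate and the volatility of the stock). Functions in $L^\infty(\mathbb{R})$ are identified when equal Lebesgue-almost everywhere. Hitsuda-Skorokhod integral: let $X\in L^2([0,T]\times\Omega)$. By the Wiener-It\^o chaos expansion, $X(t,\omega)=\sum_{n=0}^\infty I_n(f_{n,t})$ in $L^2(\Omega)$, where $I_n$ is the $n$-fold multiple Wiener-It\^o integral and $f_{n,t}\in L^2([0,T]^n)$ are symmetric. Write $f_n(t_1,\dots,t_n,t):=f_{n,t}(t_1,\dots,t_n)$, a function on $[0,T]^{n+1}$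 symmetric in its first $n$ variables, and let $\hat f_n$ be its symmetrization in all $n+1$ variables, namely $\frac{1}{n+1}$ times the sum of $f_n(t_1,\dots,t_{n+1})$ and of the $n$ functions obtained from it by exchanging the last variable $t_{n+1}$ with $t_i$, $i=1,\dots,n$. Then $\int_0^TX(t,\omega)\,\delta B(t):=\sum_{n=0}^\infty I_{n+1}(\hat f_n)$, provided that the series converges in $L^2(\Omega)$. For $0\le t\le T$, $\int_0^tX(s)\,\delta B(s)$ is the integral of $X\mathbf{1}_{[0,t]}$. The equation for $S_0$ is an ordinary differential equation with random initial condition, solved pathwise. The equation for $S_1$ means $S_1(t)=S_1(0)+\mu\int_0^tS_1(s)\,ds+\sigma\int_0^tS_1(s)\,\delta B(s)$, $t\in[0,T]$; $S_1$ denotes the unique solution of this initial value problem. *)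

theory Defs
  imports "HOL-Probability.Probability"
begin

definition square_integrable :: "'a measure \<Rightarrow> ('a \<Rightarrow> real) \<Rightarrow> bool" where
  "square_integrable N g \<longleftrightarrow> g \<in> borel_measurable N \<and> integrable N (\<lambda>x. (g x)\<^sup>2)"

definition L2_tendsto :: "'a measure \<Rightarrow> (nat \<Rightarrow> 'a \<Rightarrow> real) \<Rightarrow> ('a \<Rightarrow> real) \<Rightarrow> bool" where
  "L2_tendsto N G g \<longleftrightarrow>
     (\<forall>k. square_integrable N (G k)) \<and> square_integrable N g \<and>
     (\<lambda>k. LINT x|N. (G k x - g x)\<^sup>2) \<longlonglongrightarrow> 0"

definition time_measure :: "real \<Rightarrow> real measure" where
  "time_measure T = restrict_space lborel {0..T}"

text \<open>Lebesgue measure on the cube of dimension \<open>n\<close>. Its points are functions on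
  \<open>{..<n}\<close>, so the coordinates are numbered from \<open>0\<close> and \<open>x(n := t)\<close> appends a last coordinate
  \<open>t\<close> to a point \<open>x\<close>.\<close>
definition cube_measure :: "real \<Rightarrow> nat \<Rightarrow> (nat \<Rightarrow> real) measure" where
  "cube_measure T n = Pi\<^sub>M {..<n} (\<lambda>_. time_measure T)"

definition time_grid :: "real \<Rightarrow> nat \<Rightarrow> (nat \<Rightarrow> real) \<Rightarrow> bool" where
  "time_grid T m s \<longleftrightarrow> 0 \<le> s 0 \<and> s m \<le> T \<and> (\<forall>j<m. s j < s (Suc j))"

definition brownian_motion :: "'a measure \<Rightarrow> real \<Rightarrow> (real \<Rightarrow> 'a \<Rightarrow> real) \<Rightarrow> bool" where
  "brownian_motion P T B \<longleftrightarrow>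
     prob_space P \<and>
     (\<forall>t\<in>{0..T}. B t \<in> borel_measurable P) \<and>
     (AE \<omega> in P. B 0 \<omega> = 0) \<and>
     (\<forall>m s. time_grid T m s \<longrightarrow>
        prob_space.indep_vars P (\<lambda>_. borel) (\<lambda>j \<omega>. B (s (Suc j)) \<omega> - B (s j) \<omega>) {..<m}) \<and>
     (\<forall>s t. 0 \<le> s \<and> s < t \<and> t \<le> T \<longrightarrow>
        distributed P lborel (\<lambda>\<omega>. B t \<omega> - B s \<omega>) (normal_density 0 (sqrt (t - s)))) \<and>
     (AE \<omega> in P. continuous_on {0..T} (\<lambda>t. B t \<omega>))"

definition generated_sigma :: "'a measure \<Rightarrow> real \<Rightarrow> (real \<Rightarrow> 'a \<Rightarrow> real) \<Rightarrow> 'a measure" where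
  "generated_sigma P T B =
     sigma (space P) {B t -` A \<inter> space P | t A. t \<in> {0..T} \<and> A \<in> sets borel}"

text \<open>The events of \<open>P\<close> lie between the \<open>\<sigma>\<close>-algebra of \<open>B\<close> and its \<open>P\<close>-completion
  (the lower inclusion is the measurability of \<open>B\<close>).\<close>
definition generated_up_to_completion :: "'a measure \<Rightarrow> real \<Rightarrow> (real \<Rightarrow> 'a \<Rightarrow> real) \<Rightarrow> bool" where
  "generated_up_to_completion P T B \<longleftrightarrow>
     sets P \<subseteq> sets (completion (restr_to_subalg P (generated_sigma P T B)))"

text \<open>Multiple Wiener-Ito integrals, following Ito: elementary integrands are step functions on
  grid boxes with pairwise distinct sides, i.e. they vanish on the diagonal boxes.\<close>
definition offdiagonal_indices :: "nat \<Rightarrow> nat \<Rightarrow> (nat \<Rightarrow> nat) set" where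
  "offdiagonal_indices n m = {k \<in> {..<n} \<rightarrow>\<^sub>E {..<m}. inj_on k {..<n}}"

definition elementary_fun ::
  "nat \<Rightarrow> nat \<Rightarrow> (nat \<Rightarrow> real) \<Rightarrow> ((nat \<Rightarrow> nat) \<Rightarrow> real) \<Rightarrow> (nat \<Rightarrow> real) \<Rightarrow> real" where
  "elementary_fun n m s a x =
     (\<Sum>k\<in>offdiagonal_indices n m. a k * (\<Prod>i<n. indicator {s (k i)<..s (Suc (k i))} (x i)))"

definition elementary_integral ::
  "(real \<Rightarrow> 'a \<Rightarrow> real) \<Rightarrow> nat \<Rightarrow> nat \<Rightarrow> (nat \<Rightarrow> real) \<Rightarrow> ((nat \<Rightarrow> nat) \<Rightarrow> real) \<Rightarrow> 'a \<Rightarrow> real" where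
  "elementary_integral B n m s a \<omega> =
     (\<Sum>k\<in>offdiagonal_indices n m. a k * (\<Prod>i<n. B (s (Suc (k i))) \<omega> - B (s (k i)) \<omega>))"

text \<open>\<open>Y\<close> is a version of the \<open>n\<close>-fold integral \<open>I\<^sub>n(g)\<close>: the continuous extension of the elementary
  integral to all square integrable \<open>g\<close>.\<close>
definition has_multiple_integral ::
  "'a measure \<Rightarrow> (real \<Rightarrow> 'a \<Rightarrow> real) \<Rightarrow> real \<Rightarrow> nat \<Rightarrow> ((nat \<Rightarrow> real) \<Rightarrow> real) \<Rightarrow> ('a \<Rightarrow> real) \<Rightarrow> bool" where
  "has_multiple_integral P B T n g Y \<longleftrightarrow>
     (\<exists>m s a. (\<forall>j. time_grid T (m j) (s j)) \<and>
        L2_tendsto (cube_measure T n) (\<lambda>j. elementary_fun n (m j) (s j) (a j)) g \<and>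
        L2_tendsto P (\<lambda>j. elementary_integral B n (m j) (s j) (a j)) Y)"

text \<open>\<open>Z = (\<Sum>n. I\<^bsub>d n\<^esub>(g n))\<close> with convergence in the mean square sense.\<close>
definition has_multiple_integral_series ::
  "'a measure \<Rightarrow> (real \<Rightarrow> 'a \<Rightarrow> real) \<Rightarrow> real \<Rightarrow> (nat \<Rightarrow> nat) \<Rightarrow> (nat \<Rightarrow> (nat \<Rightarrow> real) \<Rightarrow> real)
     \<Rightarrow> ('a \<Rightarrow> real) \<Rightarrow> bool" where
  "has_multiple_integral_series P B T d g Z \<longleftrightarrow>
     (\<exists>J. (\<forall>n. has_multiple_integral P B T (d n) (g n) (J n)) \<and>
          L2_tendsto P (\<lambda>N \<omega>. \<Sum>n<N. J n \<omega>) Z)"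

definition symmetric_kernel :: "real \<Rightarrow> nat \<Rightarrow> ((nat \<Rightarrow> real) \<Rightarrow> real) \<Rightarrow> bool" where
  "symmetric_kernel T n g \<longleftrightarrow>
     (\<forall>p. p permutes {..<n} \<longrightarrow> (AE x in cube_measure T n. g (x \<circ> p) = g x))"

definition has_chaos_expansion ::
  "'a measure \<Rightarrow> (real \<Rightarrow> 'a \<Rightarrow> real) \<Rightarrow> real \<Rightarrow> ('a \<Rightarrow> real) \<Rightarrow> (nat \<Rightarrow> (nat \<Rightarrow> real) \<Rightarrow> real) \<Rightarrow> bool" where
  "has_chaos_expansion P B T Z g \<longleftrightarrow>
     (\<forall>n. symmetric_kernel T n (g n)) \<and> has_multiple_integral_series P B T (\<lambda>n. n) g Z"

text \<open>Symmetrization of a function of \<open>n + 1\<close> variables (coordinates \<open>0, \<dots>, n\<close>) that is already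
  symmetric in the first \<open>n\<close> ones; the summand \<open>i = n\<close> is \<open>h\<close> itself.\<close>
definition symmetrize_last :: "nat \<Rightarrow> ((nat \<Rightarrow> real) \<Rightarrow> real) \<Rightarrow> (nat \<Rightarrow> real) \<Rightarrow> real" where
  "symmetrize_last n h x = (\<Sum>i\<le>n. h (x \<circ> Transposition.transpose i n)) / real (n + 1)"

text \<open>\<open>Y\<close> is a version of the Hitsuda-Skorokhod integral of \<open>X\<close> over \<open>{0..T}\<close>. The kernel \<open>h n\<close> is
  the function \<open>f\<^sub>n(t\<^sub>1, \<dots>, t\<^sub>n, t)\<close> of \<open>n + 1\<close> variables.\<close>
definition has_HS_integral ::
  "'a measure \<Rightarrow> (real \<Rightarrow> 'a \<Rightarrow> real) \<Rightarrow> real \<Rightarrow> (real \<Rightarrow> 'a \<Rightarrow> real) \<Rightarrow> ('a \<Rightarrow> real) \<Rightarrow> bool" where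
  "has_HS_integral P B T X Y \<longleftrightarrow>
     square_integrable (time_measure T \<Otimes>\<^sub>M P) (\<lambda>(t, \<omega>). X t \<omega>) \<and>
     (\<exists>h. (\<forall>n. square_integrable (cube_measure T (Suc n)) (h n)) \<and>
          (AE t in time_measure T. has_chaos_expansion P B T (X t) (\<lambda>n x. h n (x(n := t)))) \<and>
          has_multiple_integral_series P B T Suc (\<lambda>n. symmetrize_last n (h n)) Y)"

definition bank_solution ::
  "'a measure \<Rightarrow> real \<Rightarrow> real \<Rightarrow> ('a \<Rightarrow> real) \<Rightarrow> (real \<Rightarrow> 'a \<Rightarrow> real) \<Rightarrow> bool" where
  "bank_solution P T \<rho> \<xi> S \<longleftrightarrow>
     (\<forall>t\<in>{0..T}. S t \<in> borel_measurable P) \<and>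
     (AE \<omega> in P. S 0 \<omega> = \<xi> \<omega> \<and>
        (\<forall>t\<in>{0..T}. ((\<lambda>t. S t \<omega>) has_real_derivative \<rho> * S t \<omega>) (at t within {0..T})))"

definition HS_stock_solution ::
  "'a measure \<Rightarrow> (real \<Rightarrow> 'a \<Rightarrow> real) \<Rightarrow> real \<Rightarrow> real \<Rightarrow> real \<Rightarrow> ('a \<Rightarrow> real) \<Rightarrow> (real \<Rightarrow> 'a \<Rightarrow> real)
     \<Rightarrow> bool" where
  "HS_stock_solution P B T \<mu> \<sigma> \<xi> S \<longleftrightarrow>
     square_integrable (time_measure T \<Otimes>\<^sub>M P) (\<lambda>(t, \<omega>). S t \<omega>) \<and>
     (AE \<omega> in P. S 0 \<omega> = \<xi> \<omega>) \<and>
     (\<forall>t\<in>{0..T}. \<exists>Y. has_HS_integral P B T (\<lambda>s \<omega>. indicator {0..t} s * S s \<omega>) Y \<and>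
        (AE \<omega> in P. S t \<omega> = S 0 \<omega> + \<mu> * (LINT s:{0..t}|lborel. S s \<omega>) + \<sigma> * Y \<omega>))"

text \<open>Representatives of the elements of \<open>L\<^sup>\<infinity>(\<real>)\<close> with values in the unit interval.\<close>
definition strategies :: "(real \<Rightarrow> real) set" where
  "strategies = {f \<in> borel_measurable lebesgue. AE x in lebesgue. 0 \<le> f x \<and> f x \<le> 1}"

end

theory Submission
  imports Defs
begin

text \<open>Multiple Wiener-Ito integrals of positive order are centred, hence so is every
  Hitsuda-Skorokhod integral, even though the integrand is not adapted. Taking expectations in the
  stock equation leaves a deterministic linear equation, so the expected stock holding grows like
  \<open>exp (\<mu> t)\<close> and the expected bank holding like \<open>exp (\<rho> t)\<close>. The expected final wealth is therefore
  strictly increasing in \<open>E[f(B(T))]\<close>, and this is maximal exactly when \<open>f = 1\<close> almost everywhere,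
  because the law of \<open>B(T)\<close> has the same null sets as Lebesgue measure.\<close>

section \<open>Mean square convergence and linear equations\<close>

lemma (in prob_space) square_expectation_le:
  fixes X :: "'a \<Rightarrow> real"
  assumes "X \<in> borel_measurable M" "integrable M (\<lambda>x. (X x)\<^sup>2)"
  shows "(expectation X)\<^sup>2 \<le> expectation (\<lambda>x. (X x)\<^sup>2)"
  using variance_eq[OF square_integrable_imp_integrable[OF assms] assms(2)] variance_positive[of X]
  by simp

lemma (in finite_measure) square_integrable_integrable:
  "square_integrable M g \<Longrightarrow> integrable M g"
  unfolding square_integrable_def by (auto intro: square_integrable_imp_integrable)

lemma square_integrable_diff:
  assumes "square_integrable N f" "square_integrable N g"
  shows "square_integrable N (\<lambda>x. f x - g x)"
proof -
  have [measurable]: "f \<in> borel_measurable N" "g \<in> borel_measurable N"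
    using assms by (auto simp: square_integrable_def)
  have "integrable N (\<lambda>x. (f x - g x)\<^sup>2)"
  proof (rule Bochner_Integration.integrable_bound)
    show "integrable N (\<lambda>x. 2 * (f x)\<^sup>2 + 2 * (g x)\<^sup>2)"
      using assms by (auto simp: square_integrable_def)
    \<comment> \<open>The difference of the two sides is \<open>(f x + g x)\<^sup>2\<close>.\<close>
    have "(f x - g x)\<^sup>2 \<le> 2 * (f x)\<^sup>2 + 2 * (g x)\<^sup>2" for x
      using zero_le_power2[of "f x + g x"] by (simp add: power2_eq_square algebra_simps)
    then show "AE x in N. norm ((f x - g x)\<^sup>2) \<le> norm (2 * (f x)\<^sup>2 + 2 * (g x)\<^sup>2)"
      by simp
  qed simp
  then show ?thesis by (simp add: square_integrable_def)
qed

text \<open>By nonnegativity of the variance, the squared mean of \<open>G k - g\<close> is at most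
  its second moment. That squared mean is \<open>(expectation g)\<^sup>2\<close> for every
  \<open>k\<close>, while the second moment tends to 0.\<close>

lemma (in prob_space) L2_tendsto_expectation_zero:
  assumes L: "L2_tendsto M G g" and Z: "\<And>k. expectation (G k) = 0"
  shows "expectation g = 0"
proof -
  have sqG: "square_integrable M (G k)" for k
    using L by (auto simp: L2_tendsto_def)
  have sqg: "square_integrable M g"
    using L by (auto simp: L2_tendsto_def)
  have "(expectation g)\<^sup>2 \<le> expectation (\<lambda>x. (G k x - g x)\<^sup>2)" for k
  proof -
    have "expectation (\<lambda>x. G k x - g x) = - expectation g"
      using sqG[of k] sqg by (simp add: square_integrable_integrable Z)
    then show ?thesis
      using square_expectation_le[of "\<lambda>x. G k x - g x"] square_integrable_diff[OF sqG sqg, of k]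
      by (simp add: square_integrable_def)
  qed
  moreover have "(\<lambda>k. expectation (\<lambda>x. (G k x - g x)\<^sup>2)) \<longlonglongrightarrow> 0"
    using L by (simp add: L2_tendsto_def)
  ultimately have "(expectation g)\<^sup>2 \<le> 0"
    by (intro LIMSEQ_le_const) auto
  then show ?thesis by simp
qed

text \<open>Integrating factor: multiplied by \<open>exp (- (c * t))\<close>, a solution has zero
  derivative and so becomes constant. This serves the bank account path by path and, later, the
  expected stock holding.\<close>

lemma linear_ODE_unique:
  fixes x :: "real \<Rightarrow> real"
  assumes D: "\<And>t. t \<in> {0..T} \<Longrightarrow> (x has_real_derivative c * x t) (at t within {0..T})"
    and t: "t \<in> {0..T}"
  shows "x t = x 0 * exp (c * t)"
proof -
  have "((\<lambda>t. x t * exp (- (c * t))) has_field_derivative 0) (at s within {0..T})"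
    if "s \<in> {0..T}" for s
    by (rule derivative_eq_intros D[OF that] refl)+ (simp add: algebra_simps)
  then obtain a where a: "x s * exp (- (c * s)) = a" if "s \<in> {0..T}" for s
    using has_field_derivative_zero_constant[of "{0..T}" "\<lambda>t. x t * exp (- (c * t))"] by auto
  have "x t * exp (- (c * t)) = x 0"
    using a[OF t] a[of 0] t by simp
  then show ?thesis
    by (simp add: exp_minus field_simps)
qed

text \<open>Regularity is bootstrapped from mere integrability: the right-hand side is continuous,
  hence so is \<open>x\<close>, and then the fundamental theorem of calculus turns the equation into
  a differential one.\<close>

lemma linear_integral_equation_unique:
  fixes x :: "real \<Rightarrow> real"
  assumes int: "set_integrable lborel {0..T} x"
    and eq: "\<And>t. t \<in> {0..T} \<Longrightarrow> x t = x 0 + c * (LINT s:{0..t}|lborel. x s)"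
    and t: "t \<in> {0..T}"
  shows "x t = x 0 * exp (c * t)"
proof -
  \<comment> \<open>Passing to the gauge integral \<open>integral\<close> opens the way to its
    continuity and differentiation theorems.\<close>
  have eq': "x t = x 0 + c * integral {0..t} x" if "t \<in> {0..T}" for t
    using that eq[OF that] set_borel_integral_eq_integral(2)[OF set_integrable_subset[OF int], of "{0..t}"]
    by auto
  have "continuous_on {0..T} (\<lambda>t. x 0 + c * integral {0..t} x)"
    by (intro continuous_intros indefinite_integral_continuous_1
        set_borel_integral_eq_integral(1)[OF int])
  then have cont: "continuous_on {0..T} x"
    by (subst continuous_on_cong[OF refl eq'])
  show ?thesis
  proof (rule linear_ODE_unique[OF _ t])
    fix s assume s: "s \<in> {0..T}"
    have "((\<lambda>t. x 0 + c * integral {0..t} x) has_real_derivative c * x s) (at s within {0..T})"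
      by (rule derivative_eq_intros integral_has_real_derivative[OF cont s] refl)+ simp
    then show "(x has_real_derivative c * x s) (at s within {0..T})"
      by (rule has_field_derivative_transform_within[OF _ zero_less_one s]) (rule eq'[symmetric])
  qed
qed

section \<open>Wiener-Ito and Hitsuda-Skorokhod integrals are centred\<close>

lemma time_grid_mono:
  assumes "time_grid T m s" "i \<le> j" "j \<le> m"
  shows "s i \<le> s j"
  using assms(2,3)
proof (induction j rule: dec_induct)
  case (step n)
  then have "s n < s (Suc n)"
    using assms(1) by (auto simp: time_grid_def)
  with step show ?case by simp
qed simp

context
  fixes P :: "'a measure" and B :: "real \<Rightarrow> 'a \<Rightarrow> real" and T :: real
  assumes bm: "brownian_motion P T B"
begin

interpretation prob_space P
  using bm by (simp add: brownian_motion_def)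

text \<open>Monotonicity keeps the grid inside \<open>{0..T}\<close>, and its strictness makes the
  variance positive, so the increment has a nondegenerate normal law of mean 0.\<close>

lemma increment_centred:
  assumes g: "time_grid T m s" and j: "j < m"
  shows "integrable P (\<lambda>\<omega>. B (s (Suc j)) \<omega> - B (s j) \<omega>)"
    and "expectation (\<lambda>\<omega>. B (s (Suc j)) \<omega> - B (s j) \<omega>) = 0"
proof -
  have lt: "s j < s (Suc j)" and "0 \<le> s j" "s (Suc j) \<le> T"
    using g j time_grid_mono[OF g, of 0 j] time_grid_mono[OF g, of "Suc j" m]
    by (auto simp: time_grid_def)
  then have D: "distributed P lborel (\<lambda>\<omega>. B (s (Suc j)) \<omega> - B (s j) \<omega>)
      (normal_density 0 (sqrt (s (Suc j) - s j)))"
    using bm by (auto simp: brownian_motion_def)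
  have pos: "0 < sqrt (s (Suc j) - s j)" using lt by simp
  show "expectation (\<lambda>\<omega>. B (s (Suc j)) \<omega> - B (s j) \<omega>) = 0"
    using normal_distributed_expectation[OF pos D] .
  show "integrable P (\<lambda>\<omega>. B (s (Suc j)) \<omega> - B (s j) \<omega>)"
    using distributed_integrable[OF D, of "\<lambda>x. x"] integrable_normal_moment_nz_1[OF pos] by simp
qed

text \<open>Off-diagonal indices select distinct grid cells, so each summand is a product of
  independent centred increments and its expectation factorizes. Order 0 is excluded because the
  empty product is 1.\<close>

lemma elementary_integral_centred:
  assumes g: "time_grid T m s" and n: "n > 0"
  shows "expectation (elementary_integral B n m s a) = 0"
proof -
  let ?D = "\<lambda>j \<omega>. B (s (Suc j)) \<omega> - B (s j) \<omega>"
  have *: "integrable P (\<lambda>\<omega>. \<Prod>i<n. ?D (k i) \<omega>) \<and> expectation (\<lambda>\<omega>. \<Prod>i<n. ?D (k i) \<omega>) = 0"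
    if k: "k \<in> offdiagonal_indices n m" for k
  proof -
    have inj: "inj_on k {..<n}" and sub: "k ` {..<n} \<subseteq> {..<m}"
      using k by (auto simp: offdiagonal_indices_def)
    \<comment> \<open>Injectivity of \<open>k\<close> turns the product over positions into one over
      a set of cells, the form to which independence applies.\<close>
    have eq: "(\<lambda>\<omega>. \<Prod>i<n. ?D (k i) \<omega>) = (\<lambda>\<omega>. \<Prod>j\<in>k ` {..<n}. ?D j \<omega>)"
      by (simp add: prod.reindex[OF inj])
    have "indep_vars (\<lambda>_. borel) ?D {..<m}"
      using bm g by (auto simp: brownian_motion_def)
    then have ind: "indep_vars (\<lambda>_. borel) ?D (k ` {..<n})"
      using sub by (rule indep_vars_subset)
    have int: "integrable P (?D j)" and zero: "expectation (?D j) = 0" if "j \<in> k ` {..<n}" for j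
      using increment_centred[OF g, of j] that sub by auto
    \<comment> \<open>A single vanishing factor suffices; position 0 exists because
      \<open>n > 0\<close>.\<close>
    have "(\<Prod>j\<in>k ` {..<n}. expectation (?D j)) = 0"
      using n zero by (intro prod_zero bexI[of _ "k 0"]) auto
    then show ?thesis
      unfolding eq
      using indep_vars_integrable[OF _ ind int] indep_vars_lebesgue_integral[OF _ ind int] by simp
  qed
  have "expectation (elementary_integral B n m s a)
      = (\<Sum>k\<in>offdiagonal_indices n m. a k * expectation (\<lambda>\<omega>. \<Prod>i<n. ?D (k i) \<omega>))"
    unfolding elementary_integral_def [abs_def]
    by (subst Bochner_Integration.integral_sum) (use * in auto)
  then show ?thesis
    using * by simp
qed

lemma multiple_integral_centred:
  assumes "has_multiple_integral P B T n g Y" "n > 0"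
  shows "expectation Y = 0"
proof -
  obtain m s a where "\<And>j. time_grid T (m j) (s j)"
    and L: "L2_tendsto P (\<lambda>j. elementary_integral B n (m j) (s j) (a j)) Y"
    using assms(1) unfolding has_multiple_integral_def by blast
  then show ?thesis
    using L2_tendsto_expectation_zero[OF L] elementary_integral_centred \<open>n > 0\<close> by simp
qed

text \<open>The kernel with index \<open>n\<close> is integrated in order \<open>Suc n\<close>, so
  the series has no constant term. All partial sums are therefore centred, and mean square limits
  preserve this.\<close>

lemma HS_integral_centred:
  assumes "has_HS_integral P B T X Y"
  shows "integrable P Y" and "expectation Y = 0"
proof -
  obtain h J where J: "\<And>n. has_multiple_integral P B T (Suc n) (symmetrize_last n (h n)) (J n)"
    and L: "L2_tendsto P (\<lambda>N \<omega>. \<Sum>n<N. J n \<omega>) Y"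
    using assms unfolding has_HS_integral_def has_multiple_integral_series_def by blast
  show "integrable P Y"
    using L by (auto simp: L2_tendsto_def square_integrable_integrable)
  have "integrable P (J n)" for n
    using J[of n] by (auto simp: has_multiple_integral_def L2_tendsto_def square_integrable_integrable)
  then have "expectation (\<lambda>\<omega>. \<Sum>n<N. J n \<omega>) = 0" for N
    using multiple_integral_centred[OF J] by simp
  then show "expectation Y = 0"
    using L2_tendsto_expectation_zero[OF L] by blast
qed

section \<open>Expected holdings\<close>

lemma bank_solution_expectation:
  assumes "bank_solution P T \<rho> \<xi> S" "T > 0" "integrable P (S 0)"
  shows "integrable P (S T)" and "expectation (S T) = expectation (S 0) * exp (\<rho> * T)"
proof -
  have meas: "S T \<in> borel_measurable P"
    using assms by (auto simp: bank_solution_def)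
  have "AE \<omega> in P. \<forall>t\<in>{0..T}. ((\<lambda>t. S t \<omega>) has_real_derivative \<rho> * S t \<omega>) (at t within {0..T})"
    using assms(1) by (auto simp: bank_solution_def)
  then have ae: "AE \<omega> in P. S T \<omega> = S 0 \<omega> * exp (\<rho> * T)"
    by eventually_elim (rule linear_ODE_unique, use \<open>T > 0\<close> in auto)
  have int: "integrable P (\<lambda>\<omega>. S 0 \<omega> * exp (\<rho> * T))"
    using assms(3) by simp
  show "integrable P (S T)"
    using integrable_cong_AE[OF meas _ ae] int by auto
  show "expectation (S T) = expectation (S 0) * exp (\<rho> * T)"
    using integral_cong_AE[OF meas _ ae] int by auto
qed

text \<open>In expectation the Skorokhod term drops out and Fubini moves the mean inside the time
  integral, leaving a deterministic linear integral equation for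
  \<open>expectation (S t)\<close>.\<close>

lemma stock_solution_expectation:
  assumes S: "HS_stock_solution P B T \<mu> \<sigma> \<xi> S" and T: "T > 0" and S_0: "integrable P (S 0)"
  shows "integrable P (S T)" and "expectation (S T) = expectation (S 0) * exp (\<mu> * T)"
proof -
  let ?\<tau> = "time_measure T"
  interpret \<tau>: finite_measure ?\<tau>
    using T by (intro finite_measureI) (simp add: time_measure_def space_restrict_space emeasure_restrict_space)
  interpret pair: pair_sigma_finite ?\<tau> P ..
  interpret pairf: finite_measure "?\<tau> \<Otimes>\<^sub>M P"
    by (intro finite_measure_pair_measure) unfold_locales
  have int: "integrable (?\<tau> \<Otimes>\<^sub>M P) (\<lambda>(t, \<omega>). S t \<omega>)"
    using S by (auto simp: HS_stock_solution_def intro: pairf.square_integrable_integrable)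
  have space: "space ?\<tau> = {0..T}"
    by (simp add: time_measure_def space_restrict_space)
  \<comment> \<open>Measurability at a single time comes from a section of the jointly measurable
    process.\<close>
  have meas: "S t \<in> borel_measurable P" if "t \<in> {0..T}" for t
    using measurable_Pair2[OF borel_measurable_integrable[OF int], of t] that by (simp add: space)
  have time: "(LINT s:{0..t}|lborel. F s) = (LINT s|?\<tau>. indicator {0..t} s * F s)"
    if "t \<in> {0..T}" for t and F :: "real \<Rightarrow> real"
    unfolding time_measure_def set_lebesgue_integral_def
    using that by (auto simp: integral_restrict_space indicator_def intro!: Bochner_Integration.integral_cong)
  let ?m = "\<lambda>t. expectation (S t)"
  have "integrable ?\<tau> ?m"
    using pair.integrable_fst'[OF int] by simp
  then have m_int: "set_integrable lborel {0..T} ?m"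
    by (simp add: time_measure_def integrable_restrict_space set_integrable_def)
  \<comment> \<open>Fubini alone gives integrability of \<open>S t\<close> only for almost every
    \<open>t\<close>; the equation gives it for every \<open>t\<close>, because its right-hand side
    is integrable.\<close>
  have *: "integrable P (S t) \<and> ?m t = ?m 0 + \<mu> * (LINT s:{0..t}|lborel. ?m s)"
    if t: "t \<in> {0..T}" for t
  proof -
    obtain Y where Y: "has_HS_integral P B T (\<lambda>s \<omega>. indicator {0..t} s * S s \<omega>) Y"
      and ae: "AE \<omega> in P. S t \<omega> = S 0 \<omega> + \<mu> * (LINT s:{0..t}|lborel. S s \<omega>) + \<sigma> * Y \<omega>"
      using S t unfolding HS_stock_solution_def by blast
    \<comment> \<open>Truncation at \<open>t\<close> does not enlarge absolute values, so joint
      integrability survives.\<close>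
    have "integrable (?\<tau> \<Otimes>\<^sub>M P) (\<lambda>(s, \<omega>). indicator {0..t} s * S s \<omega>)"
    proof (rule Bochner_Integration.integrable_bound[OF int])
      have "{0..t} \<inter> {0..T} \<in> sets ?\<tau>"
        by (auto simp: time_measure_def sets_restrict_space)
      then have "(indicator {0..t} :: real \<Rightarrow> real) \<in> borel_measurable ?\<tau>"
        by (simp add: borel_measurable_indicator_iff space)
      then show "(\<lambda>(s, \<omega>). indicator {0..t} s * S s \<omega>) \<in> borel_measurable (?\<tau> \<Otimes>\<^sub>M P)"
        using borel_measurable_integrable[OF int] by (simp add: split_beta')
    qed (auto simp: indicator_def)
    note Fub = pair.integrable_snd[OF this] pair.Fubini_integral[OF this]
    let ?I = "\<lambda>\<omega>. LINT s:{0..t}|lborel. S s \<omega>"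
    have I: "integrable P ?I" "expectation ?I = (LINT s:{0..t}|lborel. ?m s)"
      using Fub by (simp_all add: time[OF t])
    let ?R = "\<lambda>\<omega>. S 0 \<omega> + \<mu> * ?I \<omega> + \<sigma> * Y \<omega>"
    have R: "integrable P ?R" "expectation ?R = ?m 0 + \<mu> * (LINT s:{0..t}|lborel. ?m s)"
      using S_0 I HS_integral_centred[OF Y] by simp_all
    then show ?thesis
      using integrable_cong_AE[OF meas[OF t] _ ae] integral_cong_AE[OF meas[OF t] _ ae] by auto
  qed
  show "integrable P (S T)"
    using * T by simp
  show "?m T = ?m 0 * exp (\<mu> * T)"
    by (rule linear_integral_equation_unique[OF m_int conjunct2[OF *]]) (use T in auto)
qed

section \<open>The law of \<open>B T\<close> and the expected wealth\<close>

lemma AE_lebesgue_imp_AE_Brownian: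
  assumes "T > 0" and "AE x in lebesgue. Q x"
  shows "AE \<omega> in P. Q (B T \<omega>)"
proof -
  \<comment> \<open>\<open>B 0\<close> vanishes only almost surely, so the normal density belongs to
    the increment; the result is carried over to \<open>B T\<close> at the end.\<close>
  let ?X = "\<lambda>\<omega>. B T \<omega> - B 0 \<omega>"
  have D: "distributed P lborel ?X (normal_density 0 (sqrt (T - 0)))"
    using bm \<open>T > 0\<close> unfolding brownian_motion_def by blast
  have "AE x in density lborel (normal_density 0 (sqrt (T - 0))). Q x"
    using assms(2) by (subst AE_density) (auto simp: AE_completion_iff)
  then have "AE x in distr P lborel ?X. Q x"
    unfolding distributed_distr_eq_density[OF D] .
  then have "AE \<omega> in P. Q (?X \<omega>)"
    by (rule AE_distrD[OF distributed_measurable[OF D]])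
  moreover have "AE \<omega> in P. B 0 \<omega> = 0"
    using bm by (simp add: brownian_motion_def)
  ultimately show ?thesis
    by eventually_elim simp
qed

text \<open>The normal density is strictly positive, so a null set for the law of \<open>B T\<close>
  is also Lebesgue null.\<close>

lemma AE_Brownian_imp_AE_lebesgue:
  fixes f :: "real \<Rightarrow> real"
  assumes "T > 0" and f: "f \<in> borel_measurable lebesgue" and ae: "AE \<omega> in P. f (B T \<omega>) = c"
  shows "AE x in lebesgue. f x = c"
proof -
  let ?X = "\<lambda>\<omega>. B T \<omega> - B 0 \<omega>"
  have D: "distributed P lborel ?X (normal_density 0 (sqrt (T - 0)))"
    using bm \<open>T > 0\<close> unfolding brownian_motion_def by blast
  \<comment> \<open>Transfer through \<open>distr\<close> needs a measurable event, while
    \<open>f\<close> is only Lebesgue measurable. A Borel version \<open>g\<close> replaces it, and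
    the preceding lemma makes the exchange harmless along \<open>B T\<close>.\<close>
  obtain g where g [measurable]: "g \<in> borel_measurable borel" and fg: "AE x in lborel. f x = g x"
    using completion_ex_borel_measurable_real[OF f] by auto
  have "AE \<omega> in P. f (B T \<omega>) = g (B T \<omega>)"
    using AE_lebesgue_imp_AE_Brownian[OF \<open>T > 0\<close>] fg by (auto simp: AE_completion_iff)
  moreover have "AE \<omega> in P. B 0 \<omega> = 0"
    using bm by (simp add: brownian_motion_def)
  ultimately have "AE \<omega> in P. g (?X \<omega>) = c"
    using ae by eventually_elim simp
  then have "AE x in distr P lborel ?X. g x = c"
    using D by (subst AE_distr_iff) (auto simp: distributed_def)
  then have "AE x in lborel. g x = c"
    unfolding distributed_distr_eq_density[OF D] using \<open>T > 0\<close>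
    by (subst (asm) AE_density) (auto simp: normal_density_pos)
  then show ?thesis
    using fg unfolding AE_completion_iff by eventually_elim simp
qed

text \<open>The initial holdings add up to \<open>M\<close>, so expected wealth is affine in the
  single number \<open>expectation (S1 0)\<close>. Working with \<open>S1 0\<close> avoids
  \<open>f (B T)\<close>, which need not be \<open>P\<close>-measurable for a Lebesgue measurable
  \<open>f\<close>.\<close>

lemma expected_wealth:
  assumes T: "T > 0" and f: "f \<in> strategies"
    and bank: "bank_solution P T \<rho> (\<lambda>\<omega>. M * (1 - f (B T \<omega>))) S0"
    and stock: "HS_stock_solution P B T \<mu> \<sigma> (\<lambda>\<omega>. M * f (B T \<omega>)) S1"
    and M: "M > 0"
  shows "expectation (\<lambda>\<omega>. S0 T \<omega> + S1 T \<omega>)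
      = M * exp (\<rho> * T) + expectation (S1 0) * (exp (\<mu> * T) - exp (\<rho> * T))"
    and "expectation (S1 0) \<le> M"
    and "expectation (S1 0) = M \<longleftrightarrow> (AE x in lebesgue. f x = 1)"
proof -
  have f_meas: "f \<in> borel_measurable lebesgue" and f01: "AE x in lebesgue. 0 \<le> f x \<and> f x \<le> 1"
    using f by (auto simp: strategies_def)
  have bd: "AE \<omega> in P. 0 \<le> f (B T \<omega>) \<and> f (B T \<omega>) \<le> 1"
    by (rule AE_lebesgue_imp_AE_Brownian[OF T f01])
  have S1_init: "AE \<omega> in P. S1 0 \<omega> = M * f (B T \<omega>)"
    using stock by (simp add: HS_stock_solution_def)
  have S0_init: "AE \<omega> in P. S0 0 \<omega> = M * (1 - f (B T \<omega>))"
    using bank by (auto simp: bank_solution_def)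
  have S1_bd: "AE \<omega> in P. 0 \<le> S1 0 \<omega> \<and> S1 0 \<omega> \<le> M"
    using bd S1_init by eventually_elim (use M in \<open>auto simp: mult_left_le\<close>)
  have "(\<lambda>(t, \<omega>). S1 t \<omega>) \<in> borel_measurable (time_measure T \<Otimes>\<^sub>M P)"
    using stock by (auto simp: HS_stock_solution_def square_integrable_def)
  from measurable_Pair2[OF this, of 0] have S1_meas: "S1 0 \<in> borel_measurable P"
    using T by (simp add: time_measure_def space_restrict_space)
  have S1_int: "integrable P (S1 0)"
    by (rule integrable_const_bound[where B = M]) (use S1_bd S1_meas in auto)
  have S0_meas: "S0 0 \<in> borel_measurable P"
    using bank T by (auto simp: bank_solution_def)
  have compl: "AE \<omega> in P. S0 0 \<omega> = M - S1 0 \<omega>"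
    using S0_init S1_init by eventually_elim (simp add: algebra_simps)
  have S0_int: "integrable P (S0 0)"
    using integrable_cong_AE[OF S0_meas _ compl] S1_int by auto
  have S0_E: "expectation (S0 0) = M - expectation (S1 0)"
    using integral_cong_AE[OF S0_meas _ compl] S1_int by (auto simp: prob_space)
  show "expectation (\<lambda>\<omega>. S0 T \<omega> + S1 T \<omega>)
      = M * exp (\<rho> * T) + expectation (S1 0) * (exp (\<mu> * T) - exp (\<rho> * T))"
    using bank_solution_expectation[OF bank T S0_int] stock_solution_expectation[OF stock T S1_int]
    by (simp add: S0_E algebra_simps)
  have gap_int: "integrable P (\<lambda>\<omega>. M - S1 0 \<omega>)" and gap_nonneg: "AE \<omega> in P. 0 \<le> M - S1 0 \<omega>"
    and gap_E: "expectation (\<lambda>\<omega>. M - S1 0 \<omega>) = M - expectation (S1 0)"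
    using S1_int S1_bd by (auto simp: prob_space)
  show "expectation (S1 0) \<le> M"
    using integral_nonneg_AE[OF gap_nonneg] gap_E by simp
  \<comment> \<open>The gap \<open>M - S1 0\<close> is almost surely nonnegative, so it has mean 0
    only if it vanishes almost surely.\<close>
  have "expectation (S1 0) = M \<longleftrightarrow> (AE \<omega> in P. M - S1 0 \<omega> = 0)"
    unfolding integral_nonneg_eq_0_iff_AE[OF gap_int gap_nonneg, symmetric] gap_E by auto
  also have "\<dots> \<longleftrightarrow> (AE \<omega> in P. f (B T \<omega>) = 1)"
  proof
    assume "AE \<omega> in P. M - S1 0 \<omega> = 0"
    then show "AE \<omega> in P. f (B T \<omega>) = 1"
      using S1_init by eventually_elim (use M in auto)
  next
    assume "AE \<omega> in P. f (B T \<omega>) = 1"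
    then show "AE \<omega> in P. M - S1 0 \<omega> = 0"
      using S1_init by eventually_elim auto
  qed
  also have "\<dots> \<longleftrightarrow> (AE x in lebesgue. f x = 1)"
    using AE_Brownian_imp_AE_lebesgue[OF T f_meas] AE_lebesgue_imp_AE_Brownian[OF T] by blast
  finally show "expectation (S1 0) = M \<longleftrightarrow> (AE x in lebesgue. f x = 1)" .
qed

end

section \<open>Optimality of the pure stock strategy\<close>

theorem corollary5p3:
  fixes P :: "'a measure" and B :: "real \<Rightarrow> 'a \<Rightarrow> real"
    and T M \<rho> \<mu> \<sigma> :: real
    and S0 S1 :: "(real \<Rightarrow> real) \<Rightarrow> real \<Rightarrow> 'a \<Rightarrow> real"
  assumes "T > 0" and "M > 0" and "\<rho> > 0" and "\<mu> > 0" and "\<sigma> > 0" and "\<mu> > \<rho>"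
    and "brownian_motion P T B"
    and "generated_up_to_completion P T B"
    and "\<And>f. f \<in> strategies \<Longrightarrow> bank_solution P T \<rho> (\<lambda>\<omega>. M * (1 - f (B T \<omega>))) (S0 f)"
    and "\<And>f. f \<in> strategies \<Longrightarrow> HS_stock_solution P B T \<mu> \<sigma> (\<lambda>\<omega>. M * f (B T \<omega>)) (S1 f)"
  shows "\<forall>f. is_arg_max (\<lambda>g. prob_space.expectation P (\<lambda>\<omega>. S0 g T \<omega> + S1 g T \<omega>))
               (\<lambda>g. g \<in> strategies) f
           \<longleftrightarrow> (AE x in lebesgue. f x = 1)"
proof
  fix f
  let ?m = "\<lambda>g. prob_space.expectation P (S1 g 0)"
  let ?V = "\<lambda>g. prob_space.expectation P (\<lambda>\<omega>. S0 g T \<omega> + S1 g T \<omega>)"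
  have V: "?V g = M * exp (\<rho> * T) + ?m g * (exp (\<mu> * T) - exp (\<rho> * T))"
    and m_le: "?m g \<le> M" and m_eq: "?m g = M \<longleftrightarrow> (AE x in lebesgue. g x = 1)"
    if "g \<in> strategies" for g
    using expected_wealth[OF assms(7,1) that assms(9,10)[OF that] assms(2)] by blast+
  \<comment> \<open>This is where \<open>\<mu> > \<rho>\<close> enters: the coefficient of the mean
    initial stock holding is positive, so comparing expected wealth means comparing these
    means.\<close>
  have gap: "exp (\<mu> * T) - exp (\<rho> * T) > 0"
    using assms by simp
  have less: "?V g < ?V h \<longleftrightarrow> ?m g < ?m h" if "g \<in> strategies" "h \<in> strategies" for g h
    unfolding V[OF that(1)] V[OF that(2)] add_less_cancel_left mult_less_cancel_right_pos[OF gap] ..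
  \<comment> \<open>The constant 1 is the competitor that forces every maximizer to reach the upper
    bound \<open>M\<close>.\<close>
  have one: "(\<lambda>_. 1) \<in> strategies"
    by (simp add: strategies_def)
  then have m_one: "?m (\<lambda>_. 1) = M"
    using m_eq by simp
  show "is_arg_max ?V (\<lambda>g. g \<in> strategies) f \<longleftrightarrow> (AE x in lebesgue. f x = 1)"
  proof
    assume max: "is_arg_max ?V (\<lambda>g. g \<in> strategies) f"
    then have f: "f \<in> strategies" and "\<not> ?V f < ?V (\<lambda>_. 1)"
      using one by (auto simp: is_arg_max_def)
    then have "\<not> ?m f < M"
      using less[OF f one] m_one by simp
    then show "AE x in lebesgue. f x = 1"
      using m_le[OF f] m_eq[OF f] by simp
  next
    assume ae: "AE x in lebesgue. f x = 1"
    \<comment> \<open>Lebesgue measure is complete, so any function almost everywhere equal to 1 is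
      measurable and hence an admissible strategy.\<close>
    have "f \<in> borel_measurable lebesgue"
      by (rule borel_measurable_AE[of "\<lambda>_. 1"]) (use ae in \<open>auto elim: eventually_mono\<close>)
    moreover have "AE x in lebesgue. 0 \<le> f x \<and> f x \<le> 1"
      using ae by eventually_elim simp
    ultimately have f: "f \<in> strategies"
      by (simp add: strategies_def)
    then have "?m f = M"
      using m_eq ae by simp
    then have "\<not> ?V f < ?V g" if "g \<in> strategies" for g
      using less[OF f that] m_le[OF that] by simp
    then show "is_arg_max ?V (\<lambda>g. g \<in> strategies) f"
      using f by (auto simp: is_arg_max_def)
  qed
qed

end
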